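(* Let $R$ be a preference profile and $P$ a random assignment. Then $P$ satisfies ex-ante favoring-eagerness-for-remaining-items (ea-FERI) with respect to $R$ if and only if there exists a collection of eating speed functions $\omega=(\omega_j)_{j\in N}$ such that $P=\mathrm{PRE}_\omega(R)$, where $\mathrm{PRE}_\omega$ is the probabilistic respecting eagerness mechanism with eating speeds $\omega$.
   Context: Setting. An assignment problem has a set $N=\{1,\dots,n\}$ of agents and a set $M$ of $n$ items (one unit each). A preference profile $R=(\succ_j)_{j\in N}$ gives each agent $j$ a strict linear order $\succ_j$ on $M$. For nonempty $S\subseteq M$, $\mathrm{top}(j,S)$ is the $\succ_j$-best item of $S$. $U(\succ_j,o)=\{o'\in M:o'\succ_jo\}\cup\{o\}$. A random assignment is a doubly stochastic $n\times n$ matrix $P=[p_{j,o}]_{j\in N,o\in M}$. ea-FERI. Given $P$, put $M_{P,0}=\emptyset$ and $E_{P,0}(o)=\emptyset$ for all $o$. For $r=1,2,\dots$ define recursively $M_{P,r}=\{o\in M:\sum_{k\in\bigcup_{r'<r}E_{P,r'}(o)}p_{k,o}<1\}$ and, for $o\in M_{P,r}$, $E_{P,r}(o)=\{j\in N:o=\mathrm{top}(j,M_{P,r})\}$ (with $E_{P,r}(o)=\emptyset$ for $o\notin M_{P,r}$). $P$ satisfies ea-FERI if for every $r\ge1$, every $o\in M_{P,r}$ and every $j\in N$: if $j\in E_{P,r'}(o)$ for some $r'<r$, then $\sum_{o'\in U(\succ_j,o)}p_{j,o'}=1$. PRE mechanisms. A collection of eating speed functions is $\omega=(\omega_j)_{j\in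 N}$ with (integrable) $\omega_j:[0,\infty)\to[0,\infty)$, $\int_0^1\omega_j(t)\,dt=1$ and $\omega_j(t)=0$ for $t>1$. $\mathrm{PRE}_\omega(R)$ is computed as follows. Start with $M'=M$, $P=0$, supplies $s(o)=1$ for all $o\in M$, elapsed times $t_j=0$ for all $j\in N$. While $M'\neq\emptyset$, perform a round: for each $o\in M'$ set $N_o=\{j\in N:\mathrm{top}(j,M')=o\}$; for each $o\in M'$ let $\rho_o$ be the minimum of the union of the sets $\{\rho\ge 0:\sum_{k\in N_o}\int_{t_k}^{t_k+\rho}\omega_k(t)\,dt=s(o)\}$ and $\{\rho\in[0,1]:\sum_{k\in N_o}\int_{t_k}^{t_k+\rho}\omega_k(t)\,dt=\sum_{k\in N_o}\int_{t_k}^{1}\omega_k(t)\,dt\}$ (so the agents in $N_o$ consume $o$ until $o$ is exhausted or all of them are satisfied); each $j\in N_o$ consumes the amount $\int_{t_j}^{t_j+\rho_o}\omega_j(t)\,dt$ of $o$, which is added to $p_{j,o}$; $s(o)$ is decreased by the total amount of $o$ consumed in this round; $t_j$ is increased by $\rho_o$ for each $j\in N_o$. At the end of the round all items with $s(o)=0$ are removed from $M'$. The output is $P$. *)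

theory Defs
  imports "HOL-Analysis.Analysis" "HOL-Library.While_Combinator"
begin

text \<open>
  Agents are the elements of a finite type \<open>'a\<close>, items those of a finite type \<open>'b\<close>.
  In a profile \<open>R\<close>, the pair \<open>(x, y) \<in> R j\<close> means that agent \<open>j\<close> strictly prefers item
  \<open>x\<close> to item \<open>y\<close>.
\<close>

definition preference_profile :: "('a \<Rightarrow> 'b rel) \<Rightarrow> bool" where
  "preference_profile R \<longleftrightarrow> (\<forall>j. strict_linear_order_on UNIV (R j))"

definition top_item :: "('a \<Rightarrow> 'b rel) \<Rightarrow> 'a \<Rightarrow> 'b set \<Rightarrow> 'b" where
  "top_item R j S = (THE x. x \<in> S \<and> (\<forall>y\<in>S. y \<noteq> x \<longrightarrow> (x, y) \<in> R j))"

definition upper_set :: "'b rel \<Rightarrow> 'b \<Rightarrow> 'b set" where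
  "upper_set r x = {y. (y, x) \<in> r} \<union> {x}"

definition random_assignment :: "('a::finite \<Rightarrow> 'b::finite \<Rightarrow> real) \<Rightarrow> bool" where
  "random_assignment P \<longleftrightarrow>
     (\<forall>j x. 0 \<le> P j x) \<and> (\<forall>j. (\<Sum>x\<in>UNIV. P j x) = 1) \<and> (\<forall>x. (\<Sum>j\<in>UNIV. P j x) = 1)"

text \<open>
  \<open>remaining R P r\<close> and \<open>eager R P r x\<close> are $M_{P,r}$ and $E_{P,r}(x)$.
\<close>

function (sequential)
  remaining :: "('a::finite \<Rightarrow> 'b::finite rel) \<Rightarrow> ('a \<Rightarrow> 'b \<Rightarrow> real) \<Rightarrow> nat \<Rightarrow> 'b set" and
  eager :: "('a::finite \<Rightarrow> 'b::finite rel) \<Rightarrow> ('a \<Rightarrow> 'b \<Rightarrow> real) \<Rightarrow> nat \<Rightarrow> 'b \<Rightarrow> 'a set"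
where
  "remaining R P r =
     (if r = 0 then {} else {x. (\<Sum>k\<in>(\<Union>r'\<in>{..<r}. eager R P r' x). P k x) < 1})"
| "eager R P r x =
     (if x \<in> remaining R P r then {j. x = top_item R j (remaining R P r)} else {})"
  by pat_completeness auto
termination
  by (relation "Wellfounded.measure (case_sum (\<lambda>(R, P, r). 2 * r) (\<lambda>(R, P, r, x). 2 * r + 1))") auto

text \<open>Both defining equations would make the simplifier loop.\<close>
declare remaining.simps [simp del] eager.simps [simp del]

definition ea_FERI :: "('a::finite \<Rightarrow> 'b::finite rel) \<Rightarrow> ('a \<Rightarrow> 'b \<Rightarrow> real) \<Rightarrow> bool" where
  "ea_FERI R P \<longleftrightarrow>
     (\<forall>r\<ge>1. \<forall>x\<in>remaining R P r. \<forall>j.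
        (\<exists>r'<r. j \<in> eager R P r' x) \<longrightarrow> (\<Sum>y\<in>upper_set (R j) x. P j y) = 1)"

text \<open>
  An eating speed function is defined on $[0,\infty)$; its values at negative arguments are
  irrelevant and left unconstrained.  Integration is Lebesgue integration, and integrals over
  intervals are oriented, which matters because an elapsed time may exceed 1.
\<close>

definition eating_speeds :: "('a \<Rightarrow> real \<Rightarrow> real) \<Rightarrow> bool" where
  "eating_speeds \<omega> \<longleftrightarrow>
     (\<forall>j. (\<forall>t\<ge>0. 0 \<le> \<omega> j t) \<and> set_integrable lebesgue {0..} (\<omega> j) \<and>
          (LINT t=0..1|lebesgue. \<omega> j t) = 1 \<and> (\<forall>t>1. \<omega> j t = 0))"

definition eaten :: "(real \<Rightarrow> real) \<Rightarrow> real \<Rightarrow> real \<Rightarrow> real" where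
  "eaten f a b = (LINT t=ereal a..ereal b|lebesgue. f t)"

record ('a, 'b) pre_state =
  items :: "'b set"
  alloc :: "'a \<Rightarrow> 'b \<Rightarrow> real"
  stock :: "'b \<Rightarrow> real"
  elapsed :: "'a \<Rightarrow> real"

definition pre_init :: "('a, 'b) pre_state" where
  "pre_init = \<lparr>items = UNIV, alloc = (\<lambda>j x. 0), stock = (\<lambda>x. 1), elapsed = (\<lambda>j. 0)\<rparr>"

definition eaters :: "('a \<Rightarrow> 'b rel) \<Rightarrow> ('a, 'b) pre_state \<Rightarrow> 'b \<Rightarrow> 'a set" where
  "eaters R s x = {j. top_item R j (items s) = x}"

definition duration ::
  "('a::finite \<Rightarrow> real \<Rightarrow> real) \<Rightarrow> ('a \<Rightarrow> 'b::finite rel) \<Rightarrow> ('a, 'b) pre_state \<Rightarrow> 'b \<Rightarrow> real"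
where
  "duration \<omega> R s x = (LEAST \<rho>. \<rho> \<in>
     {\<rho>. 0 \<le> \<rho> \<and>
        (\<Sum>k\<in>eaters R s x. eaten (\<omega> k) (elapsed s k) (elapsed s k + \<rho>)) = stock s x} \<union>
     {\<rho>. 0 \<le> \<rho> \<and> \<rho> \<le> 1 \<and>
        (\<Sum>k\<in>eaters R s x. eaten (\<omega> k) (elapsed s k) (elapsed s k + \<rho>)) =
        (\<Sum>k\<in>eaters R s x. eaten (\<omega> k) (elapsed s k) 1)})"

text \<open>
  In a round with available items \<open>M'\<close> every agent eats from exactly one item, so the items of
  \<open>M'\<close> can be processed simultaneously.
\<close>

definition pre_round ::
  "('a::finite \<Rightarrow> real \<Rightarrow> real) \<Rightarrow> ('a \<Rightarrow> 'b::finite rel) \<Rightarrow> ('a, 'b) pre_state \<Rightarrow> ('a, 'b) pre_state"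
where
  "pre_round \<omega> R s =
     (let M' = items s;
          t = elapsed s;
          c = (\<lambda>j x. if x \<in> M' \<and> j \<in> eaters R s x
                     then eaten (\<omega> j) (t j) (t j + duration \<omega> R s x) else 0);
          s' = (\<lambda>x. stock s x - (\<Sum>j\<in>UNIV. c j x))
      in \<lparr>items = {x \<in> M'. s' x \<noteq> 0},
          alloc = (\<lambda>j x. alloc s j x + c j x),
          stock = s',
          elapsed = (\<lambda>j. t j + duration \<omega> R s (top_item R j M'))\<rparr>)"

text \<open>
  If \<open>eating_speeds \<omega>\<close> holds and \<open>R\<close> is a profile over equally many agents and items, then each
  round exhausts at least one item, so the loop terminates.
\<close>

definition PRE ::
  "('a::finite \<Rightarrow> real \<Rightarrow> real) \<Rightarrow> ('a \<Rightarrow> 'b::finite rel) \<Rightarrow> 'a \<Rightarrow> 'b \<Rightarrow> real"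
where
  "PRE \<omega> R = alloc (while (\<lambda>s. items s \<noteq> {}) (pre_round \<omega> R) pre_init)"

end

theory Submission
  imports Defs
begin

text \<open>
  If \<open>P\<close> is the outcome of a run, then the agents eating an item that survives a round are satisfied
  after it, so nobody eats the same item in two rounds. Hence the available items and the amounts
  eaten before round \<open>r\<close> can be read off \<open>P\<close>: they are \<open>remaining R P r\<close> and the shares
  \<open>P j x\<close> with \<open>j \<in> eager R P r' x\<close> for some \<open>r' < r\<close>, and satisfaction is the sum condition of
  ea-FERI. Conversely, with \<open>n\<close> items ea-FERI forces \<open>remaining R P (n + 1) = {}\<close>. Cut the unit of time
  into \<open>n\<close> equal slots and let agent \<open>j\<close> eat in slot \<open>r\<close>, at constant speed, the share of \<open>P\<close> that
  \<open>j\<close> first becomes eager for in round \<open>r\<close>. Every round then takes exactly one slot for each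
  unsatisfied agent, because its eaters stop precisely when the item is exhausted or, by ea-FERI,
  when all of them are satisfied.
\<close>

section \<open>Best items\<close>

text \<open>Induction over the finite set gives a greatest item, and transitivity with irreflexivity
  makes it unique, so the \<open>THE\<close> in \<open>top_item\<close> denotes it.\<close>

lemma top_item_greatest:
  fixes S :: "'b::finite set"
  assumes "preference_profile R" "S \<noteq> {}"
  shows top_item_in: "top_item R j S \<in> S"
    and top_item_best: "\<And>y. y \<in> S \<Longrightarrow> y \<noteq> top_item R j S \<Longrightarrow> (top_item R j S, y) \<in> R j"
proof -
  have tr: "trans (R j)" and ir: "irrefl (R j)" and tot: "total_on UNIV (R j)"
    using assms(1) by (auto simp: preference_profile_def strict_linear_order_on_def)
  have "finite S" by simp
  then have "\<exists>x\<in>S. \<forall>y\<in>S. y \<noteq> x \<longrightarrow> (x, y) \<in> R j"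
    using assms(2)
  proof (induction S rule: finite_ne_induct)
    case (insert a S)
    then obtain x where x: "x \<in> S" "\<forall>y\<in>S. y \<noteq> x \<longrightarrow> (x, y) \<in> R j" by blast
    show ?case
    proof (cases "(a, x) \<in> R j")
      case True
      then have "\<forall>y\<in>insert a S. y \<noteq> a \<longrightarrow> (a, y) \<in> R j"
        using x tr by (metis insertE transD)
      then show ?thesis by blast
    next
      case False
      then have "x = a \<or> (x, a) \<in> R j" using tot by (auto simp: total_on_def)
      then show ?thesis using x by auto
    qed
  qed auto
  moreover have "x = x'"
    if "x \<in> S" "\<forall>y\<in>S. y \<noteq> x \<longrightarrow> (x, y) \<in> R j" "x' \<in> S" "\<forall>y\<in>S. y \<noteq> x' \<longrightarrow> (x', y) \<in> R j"
    for x x'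
    using that tr ir by (metis irrefl_def transD)
  ultimately have "\<exists>!x. x \<in> S \<and> (\<forall>y\<in>S. y \<noteq> x \<longrightarrow> (x, y) \<in> R j)" by blast
  from theI'[OF this] show "top_item R j S \<in> S"
    "\<And>y. y \<in> S \<Longrightarrow> y \<noteq> top_item R j S \<Longrightarrow> (top_item R j S, y) \<in> R j"
    unfolding top_item_def by auto
qed

lemma preferred_to_top_item_notin:
  fixes S :: "'b::finite set"
  assumes "preference_profile R" "(y, top_item R j S) \<in> R j"
  shows "y \<notin> S"
proof
  assume y: "y \<in> S"
  have tr: "trans (R j)" and ir: "irrefl (R j)"
    using assms(1) by (auto simp: preference_profile_def strict_linear_order_on_def)
  have "y \<noteq> top_item R j S" using assms(2) ir by (metis irrefl_def)
  moreover have "S \<noteq> {}" using y by blast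
  ultimately have "(top_item R j S, y) \<in> R j" using top_item_best[OF assms(1) _ y] by blast
  then show False using assms(2) tr ir by (meson irrefl_def transD)
qed

section \<open>The rounds of an assignment\<close>

text \<open>The part of \<open>P\<close> handed out before round \<open>r\<close> if every agent
  takes its whole share of an item on first becoming eager for it. It can be compared entry by
  entry, and it is the counterpart of \<open>alloc\<close> in a run.\<close>

definition acquired ::
  "('a::finite \<Rightarrow> 'b::finite rel) \<Rightarrow> ('a \<Rightarrow> 'b \<Rightarrow> real) \<Rightarrow> nat \<Rightarrow> 'a \<Rightarrow> 'b \<Rightarrow> real"
where
  "acquired R P r j x = (if j \<in> (\<Union>r'\<in>{..<r}. eager R P r' x) then P j x else 0)"

lemma eager_0 [simp]: "eager R P 0 x = {}"
  by (simp add: eager.simps remaining.simps)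

lemma acquired_1 [simp]: "acquired R P (Suc 0) j x = 0"
  by (simp add: acquired_def)

lemma remaining_eq_acquired: "0 < r \<Longrightarrow> remaining R P r = {x. (\<Sum>j\<in>UNIV. acquired R P r j x) < 1}"
  by (simp add: remaining.simps[of R P r] acquired_def sum.If_cases Collect_bex_eq)

text \<open>The entry is set to \<open>P j x\<close>, not increased by it: eagerness for the same
  item in a later round adds nothing.\<close>

lemma acquired_Suc:
  "acquired R P (Suc r) j x =
    (if x \<in> remaining R P r \<and> top_item R j (remaining R P r) = x then P j x
     else acquired R P r j x)"
  by (auto simp: acquired_def lessThan_Suc eager.simps)

lemma acquired_mono:
  assumes "\<And>j x. 0 \<le> P j x" "r \<le> r'"
  shows "acquired R P r j x \<le> acquired R P r' j x"
  using assms by (auto simp: acquired_def)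

lemma acquired_le:
  assumes "\<And>j x. 0 \<le> P j x"
  shows "acquired R P r j x \<le> P j x" "0 \<le> acquired R P r j x"
  using assms by (auto simp: acquired_def)

text \<open>Acquired sums only grow; \<open>0 < r\<close> excludes round 0, whose set is empty by
  convention.\<close>

lemma remaining_antimono:
  assumes "\<And>j x. 0 \<le> P j x" "0 < r" "r \<le> r'"
  shows "remaining R P r' \<subseteq> remaining R P r"
proof -
  have "(\<Sum>j\<in>UNIV. acquired R P r j x) \<le> (\<Sum>j\<in>UNIV. acquired R P r' j x)" for x
    by (intro sum_mono acquired_mono assms)
  then show ?thesis
    using assms by (auto simp: remaining_eq_acquired intro: le_less_trans)
qed

section \<open>Least stopping times\<close>

text \<open>By the intermediate value theorem no stopping time comes before the first time in
  \<open>{0..1}\<close> at which \<open>g\<close> equals \<open>min s (g 1)\<close>. Such times form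
  a compact nonempty set \<open>C\<close>, whose least element is itself a stopping time.\<close>

lemma least_stopping_time:
  fixes g :: "real \<Rightarrow> real"
  assumes cont: "continuous_on {0..1} g"
    and mono: "\<And>a b. 0 \<le> a \<Longrightarrow> a \<le> b \<Longrightarrow> g a \<le> g b"
    and g0: "g 0 = 0" and s: "0 \<le> s"
  defines "D \<equiv> {\<rho>. 0 \<le> \<rho> \<and> g \<rho> = s} \<union> {\<rho>. 0 \<le> \<rho> \<and> \<rho> \<le> 1 \<and> g \<rho> = g 1}"
  shows "0 \<le> (LEAST \<rho>. \<rho> \<in> D)" "g (LEAST \<rho>. \<rho> \<in> D) = min s (g 1)"
    and "\<And>\<rho>. \<rho> \<in> D \<Longrightarrow> (LEAST \<rho>. \<rho> \<in> D) \<le> \<rho>"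
proof -
  define C where "C = {\<rho>\<in>{0..1}. g \<rho> = min s (g 1)}"
  have reach: "\<exists>c\<in>C. c \<le> \<rho>" if "0 \<le> \<rho>" "\<rho> \<le> 1" "min s (g 1) \<le> g \<rho>" for \<rho>
  proof -
    have "0 \<le> g 1" using mono[of 0 1] g0 by simp
    then have "g 0 \<le> min s (g 1)" using g0 s by simp
    moreover have "continuous_on {0..\<rho>} g"
      using that by (intro continuous_on_subset[OF cont]) auto
    ultimately have "\<exists>c\<ge>0. c \<le> \<rho> \<and> g c = min s (g 1)"
      using IVT'[of g 0 "min s (g 1)" \<rho>] that by blast
    then show ?thesis using that by (auto simp: C_def)
  qed
  have "closed C"
    unfolding C_def using cont by (intro continuous_closed_preimage_constant) auto
  moreover have "bounded C"
    by (rule bounded_subset[of "{0..1}"]) (auto simp: C_def)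
  ultimately have "compact C" by (simp add: compact_eq_bounded_closed)
  moreover have "C \<noteq> {}" using reach[of 1] by auto
  ultimately obtain m where m: "m \<in> C" "\<And>c. c \<in> C \<Longrightarrow> m \<le> c"
    using compact_attains_inf[of C] by metis
  have "m \<in> D" using m(1) by (auto simp: C_def D_def min_def split: if_splits)
  moreover have low: "m \<le> \<rho>" if "\<rho> \<in> D" for \<rho>
  proof (cases "\<rho> \<le> 1")
    case True
    moreover have "0 \<le> \<rho>" "min s (g 1) \<le> g \<rho>" using that by (auto simp: D_def)
    ultimately obtain c where "c \<in> C" "c \<le> \<rho>" using reach[of \<rho>] by blast
    then show ?thesis using m(2) by force
  next
    case False
    then show ?thesis using m(1) by (auto simp: C_def)
  qed
  ultimately have L: "(LEAST \<rho>. \<rho> \<in> D) = m" by (intro Least_equality) auto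
  show "0 \<le> (LEAST \<rho>. \<rho> \<in> D)" "g (LEAST \<rho>. \<rho> \<in> D) = min s (g 1)"
    "\<And>\<rho>. \<rho> \<in> D \<Longrightarrow> (LEAST \<rho>. \<rho> \<in> D) \<le> \<rho>"
    unfolding L using m(1) low by (auto simp: C_def)
qed

section \<open>Runs of the mechanism\<close>

locale pre_run =
  fixes R :: "'a::finite \<Rightarrow> 'b::finite rel" and \<omega> :: "'a \<Rightarrow> real \<Rightarrow> real"
  assumes card_eq: "CARD('a) = CARD('b)"
    and profile: "preference_profile R"
    and speeds: "eating_speeds \<omega>"
begin

section \<open>Cumulative consumption as a function of elapsed time\<close>

definition F :: "'a \<Rightarrow> real \<Rightarrow> real" where
  "F j t = integral {0..t} (\<omega> j)"

lemma set_integrable_speed: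
  assumes "0 \<le> a" "S \<subseteq> {a..}" "S \<in> sets lebesgue"
  shows "set_integrable lebesgue S (\<omega> j)"
proof (rule set_integrable_subset)
  show "set_integrable lebesgue {0..} (\<omega> j)" using speeds by (simp add: eating_speeds_def)
  show "S \<subseteq> {0..}" using assms(1,2) by (meson atLeast_subset_iff order_trans)
qed (rule assms)

lemma speed_integrable_on: "0 \<le> a \<Longrightarrow> \<omega> j integrable_on {a..b}"
  by (rule set_lebesgue_integral_eq_integral(1)) (rule set_integrable_speed[of a]; simp)

lemma F_add:
  assumes "0 \<le> a" "a \<le> b"
  shows "F j b = F j a + integral {a..b} (\<omega> j)"
  unfolding F_def using assms
  by (intro Henstock_Kurzweil_Integration.integral_combine[symmetric] speed_integrable_on) auto

lemma eaten_speed_le: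
  assumes "0 \<le> a" "a \<le> b"
  shows "eaten (\<omega> j) a b = F j b - F j a"
proof -
  have "eaten (\<omega> j) a b = integral {a<..<b} (\<omega> j)"
    unfolding eaten_def interval_lebesgue_integral_def using assms
    by (simp add: set_lebesgue_integral_eq_integral(2)[OF set_integrable_speed[of a]] subset_iff)
  then show ?thesis using F_add[OF assms, of j] by (simp add: integral_open_interval_real)
qed

text \<open>Orientation makes the formula hold for \<open>b < a\<close> too, which covers the
  integrals up to 1 in \<open>duration\<close> when the elapsed time exceeds 1.\<close>

lemma eaten_speed:
  assumes "0 \<le> a" "0 \<le> b"
  shows "eaten (\<omega> j) a b = F j b - F j a"
proof (cases "a \<le> b")
  case False
  have "eaten (\<omega> j) a b = - eaten (\<omega> j) b a"
    using False by (simp add: eaten_def interval_lebesgue_integral_def)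
  then show ?thesis using False assms by (simp add: eaten_speed_le)
qed (use assms in \<open>simp add: eaten_speed_le\<close>)

lemma F_0 [simp]: "F j 0 = 0"
  by (simp add: F_def)

lemma F_mono: "0 \<le> a \<Longrightarrow> a \<le> b \<Longrightarrow> F j a \<le> F j b"
  using Henstock_Kurzweil_Integration.integral_nonneg[OF speed_integrable_on[of a j b]] speeds
  by (simp add: F_add[of a b j] eating_speeds_def)

lemma F_ge_1:
  assumes "1 \<le> t"
  shows "F j t = 1"
proof -
  have "F j 1 = 1"
    using eaten_speed[of 0 1 j] speeds
    by (simp add: eaten_def eating_speeds_def zero_ereal_def one_ereal_def)
  \<comment> \<open>Speeds are known to vanish only strictly after 1, so the point 1 is discarded as
    a null set.\<close>
  moreover have "integral {1..t} (\<omega> j) = integral {1..t} (\<lambda>_. 0)"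
    using speeds
    by (intro integral_spike[of "{1}"]) (auto simp: eating_speeds_def)
  ultimately show ?thesis using F_add[of 1 t j] assms by simp
qed

lemma F_le_1: "0 \<le> t \<Longrightarrow> F j t \<le> 1"
  using F_mono[of t "max 1 t" j] F_ge_1[of "max 1 t" j] by simp

lemma continuous_on_F: "continuous_on {0..b} (F j)"
  unfolding F_def by (intro indefinite_integral_continuous_1 speed_integrable_on) simp

lemma F_sated: "F j a = 1 \<Longrightarrow> 0 \<le> a \<Longrightarrow> a \<le> b \<Longrightarrow> F j b = 1"
  using F_mono[of a b j] F_le_1[of b j] by simp

text \<open>The loop invariant. Its row equation lets \<open>F j (elapsed s j) = 1\<close> be read
  as: \<open>j\<close> has received one unit and is satisfied.\<close>

definition consistent :: "('a, 'b) pre_state \<Rightarrow> bool" where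
  "consistent s \<longleftrightarrow>
    (\<forall>j. 0 \<le> elapsed s j \<and> (\<Sum>x\<in>UNIV. alloc s j x) = F j (elapsed s j)) \<and>
    (\<forall>x. stock s x = 1 - (\<Sum>j\<in>UNIV. alloc s j x) \<and> 0 \<le> stock s x) \<and>
    items s = {x. stock s x \<noteq> 0}"

lemma items_consistent:
  assumes "consistent s"
  shows "items s = {x. (\<Sum>j\<in>UNIV. alloc s j x) < 1}"
proof -
  have stock: "stock s x = 1 - (\<Sum>j\<in>UNIV. alloc s j x)" "0 \<le> stock s x" for x
    using assms unfolding consistent_def by blast+
  have "stock s x \<noteq> 0 \<longleftrightarrow> (\<Sum>j\<in>UNIV. alloc s j x) < 1" for x
    using stock[of x] by auto
  moreover have "items s = {x. stock s x \<noteq> 0}"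
    using assms unfolding consistent_def by blast
  ultimately show ?thesis by simp
qed

text \<open>An instance of \<open>least_stopping_time\<close>, with \<open>g\<close> the joint
  consumption of the eaters. Elapsed times are nonnegative, so one more unit of time satisfies
  everybody and \<open>g 1\<close> is the whole remaining appetite.\<close>

lemma duration_facts:
  assumes s: "consistent s"
  shows duration_nonneg: "0 \<le> duration \<omega> R s x"
    and duration_amount:
      "(\<Sum>k\<in>eaters R s x. F k (elapsed s k + duration \<omega> R s x) - F k (elapsed s k)) =
        min (stock s x) (\<Sum>k\<in>eaters R s x. 1 - F k (elapsed s k))"
    and duration_le_exhausted:
      "\<And>\<rho>. 0 \<le> \<rho> \<Longrightarrow>
        (\<Sum>k\<in>eaters R s x. F k (elapsed s k + \<rho>) - F k (elapsed s k)) = stock s x \<Longrightarrow>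
        duration \<omega> R s x \<le> \<rho>"
    and duration_le_sated:
      "\<And>\<rho>. 0 \<le> \<rho> \<Longrightarrow> \<rho> \<le> 1 \<Longrightarrow>
        (\<Sum>k\<in>eaters R s x. F k (elapsed s k + \<rho>) - F k (elapsed s k)) =
          (\<Sum>k\<in>eaters R s x. 1 - F k (elapsed s k)) \<Longrightarrow>
        duration \<omega> R s x \<le> \<rho>"
proof -
  define g where "g \<rho> = (\<Sum>k\<in>eaters R s x. F k (elapsed s k + \<rho>) - F k (elapsed s k))" for \<rho>
  let ?D = "{\<rho>. 0 \<le> \<rho> \<and> g \<rho> = stock s x} \<union> {\<rho>. 0 \<le> \<rho> \<and> \<rho> \<le> 1 \<and> g \<rho> = g 1}"
  have t: "0 \<le> elapsed s k" for k using s by (simp add: consistent_def)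
  have g1: "g 1 = (\<Sum>k\<in>eaters R s x. 1 - F k (elapsed s k))"
    unfolding g_def using t by (intro sum.cong) (auto simp: F_ge_1)
  have e: "(\<Sum>k\<in>eaters R s x. eaten (\<omega> k) (elapsed s k) (elapsed s k + \<rho>)) = g \<rho>" if "0 \<le> \<rho>" for \<rho>
    unfolding g_def using t that by (intro sum.cong) (auto simp: eaten_speed)
  have e1: "(\<Sum>k\<in>eaters R s x. eaten (\<omega> k) (elapsed s k) 1) = g 1"
    unfolding g1 using t by (intro sum.cong) (auto simp: eaten_speed F_ge_1)
  have d: "duration \<omega> R s x = (LEAST \<rho>. \<rho> \<in> ?D)"
    unfolding duration_def by (rule arg_cong[where f = Least]) (auto simp: e e1)
  have "continuous_on {0..1} (\<lambda>\<rho>. F k (elapsed s k + \<rho>))" for k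
    using t[of k]
    by (intro continuous_on_compose2[OF continuous_on_F[of "elapsed s k + 1" k]])
       (auto intro!: continuous_intros)
  then have cont: "continuous_on {0..1} g"
    unfolding g_def by (intro continuous_intros)
  have mono: "g a \<le> g b" if "0 \<le> a" "a \<le> b" for a b
    unfolding g_def using t that by (intro sum_mono diff_right_mono F_mono) (auto simp: add_nonneg_nonneg)
  have g0: "g 0 = 0" by (simp add: g_def)
  have st: "0 \<le> stock s x" using s unfolding consistent_def by blast
  note least = least_stopping_time[OF cont mono g0 st]
  have *: "0 \<le> duration \<omega> R s x" "g (duration \<omega> R s x) = min (stock s x) (g 1)"
    "\<And>\<rho>. \<rho> \<in> ?D \<Longrightarrow> duration \<omega> R s x \<le> \<rho>"
    unfolding d by (rule least; assumption)+
  show "0 \<le> duration \<omega> R s x" by (rule *)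
  show "(\<Sum>k\<in>eaters R s x. F k (elapsed s k + duration \<omega> R s x) - F k (elapsed s k)) =
        min (stock s x) (\<Sum>k\<in>eaters R s x. 1 - F k (elapsed s k))"
    using *(2) unfolding g1 unfolding g_def .
  show "duration \<omega> R s x \<le> \<rho>" if "0 \<le> \<rho>"
    "(\<Sum>k\<in>eaters R s x. F k (elapsed s k + \<rho>) - F k (elapsed s k)) = stock s x" for \<rho>
    using that *(3) by (simp add: g_def)
  show "duration \<omega> R s x \<le> \<rho>" if "0 \<le> \<rho>" "\<rho> \<le> 1"
    "(\<Sum>k\<in>eaters R s x. F k (elapsed s k + \<rho>) - F k (elapsed s k)) =
          (\<Sum>k\<in>eaters R s x. 1 - F k (elapsed s k))" for \<rho>
    using that *(3) unfolding g1[symmetric] by (simp add: g_def)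
qed

section \<open>The effect of one round\<close>

abbreviation best :: "('a, 'b) pre_state \<Rightarrow> 'a \<Rightarrow> 'b" where
  "best s j \<equiv> top_item R j (items s)"

definition consumed :: "('a, 'b) pre_state \<Rightarrow> 'a \<Rightarrow> real" where
  "consumed s j = F j (elapsed s j + duration \<omega> R s (best s j)) - F j (elapsed s j)"

lemma elapsed_round: "elapsed (pre_round \<omega> R s) j = elapsed s j + duration \<omega> R s (best s j)"
  by (simp add: pre_round_def Let_def)

lemma alloc_round_notin: "x \<notin> items s \<Longrightarrow> alloc (pre_round \<omega> R s) j x = alloc s j x"
  by (simp add: pre_round_def Let_def)

lemma alloc_round_other: "x \<noteq> best s j \<Longrightarrow> alloc (pre_round \<omega> R s) j x = alloc s j x"
  by (auto simp: pre_round_def Let_def eaters_def)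

lemma items_round_subset: "items (pre_round \<omega> R s) \<subseteq> items s"
  by (auto simp: pre_round_def Let_def)

lemma alloc_round:
  assumes "consistent s" "items s \<noteq> {}"
  shows "alloc (pre_round \<omega> R s) j x = alloc s j x + (if x = best s j then consumed s j else 0)"
  using assms top_item_in[OF profile assms(2), of j] duration_nonneg[OF assms(1)]
  by (auto simp: pre_round_def Let_def eaters_def consumed_def eaten_speed consistent_def)

lemma sum_consumed_eaters:
  assumes "consistent s"
  shows "(\<Sum>k\<in>eaters R s x. consumed s k) =
    min (stock s x) (\<Sum>k\<in>eaters R s x. 1 - F k (elapsed s k))"
  unfolding duration_amount[OF assms, symmetric]
  by (intro sum.cong) (auto simp: consumed_def eaters_def)

lemma sum_alloc_round:
  assumes "consistent s" "items s \<noteq> {}"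
  shows "(\<Sum>j\<in>UNIV. alloc (pre_round \<omega> R s) j x) =
    (\<Sum>j\<in>UNIV. alloc s j x) + (\<Sum>k\<in>eaters R s x. consumed s k)"
  by (simp add: alloc_round[OF assms] sum.distrib eaters_def sum.If_cases eq_commute)

lemma stock_round:
  "stock (pre_round \<omega> R s) x = stock s x -
    ((\<Sum>j\<in>UNIV. alloc (pre_round \<omega> R s) j x) - (\<Sum>j\<in>UNIV. alloc s j x))"
  by (simp add: pre_round_def Let_def sum.distrib)

lemma items_round: "items (pre_round \<omega> R s) = {x \<in> items s. stock (pre_round \<omega> R s) x \<noteq> 0}"
  by (simp add: pre_round_def Let_def)

lemma consistent_round:
  assumes s: "consistent s" and ne: "items s \<noteq> {}"
  shows "consistent (pre_round \<omega> R s)"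
proof -
  have stock: "stock (pre_round \<omega> R s) x = stock s x - (\<Sum>k\<in>eaters R s x. consumed s k)" for x
    by (simp add: stock_round sum_alloc_round[OF s ne])
  have "0 \<le> stock (pre_round \<omega> R s) x" for x
    by (simp add: stock sum_consumed_eaters[OF s])
  moreover have "0 \<le> elapsed (pre_round \<omega> R s) j" for j
    using s duration_nonneg[OF s] by (simp add: elapsed_round consistent_def)
  moreover have "(\<Sum>x\<in>UNIV. alloc (pre_round \<omega> R s) j x) = F j (elapsed (pre_round \<omega> R s) j)" for j
    using s by (simp add: alloc_round[OF s ne] sum.distrib consumed_def elapsed_round consistent_def)
  moreover have "stock (pre_round \<omega> R s) x = 1 - (\<Sum>j\<in>UNIV. alloc (pre_round \<omega> R s) j x)" for x
    using s by (simp add: stock_round consistent_def)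
  \<comment> \<open>An exhausted item is nobody's best item, so its stock stays 0 and
    \<open>items\<close> remains the set of items with nonzero stock.\<close>
  moreover have "x \<in> items s" if "stock (pre_round \<omega> R s) x \<noteq> 0" for x
  proof (rule ccontr)
    assume "x \<notin> items s"
    then have "stock s x = 0" using s by (auto simp: consistent_def)
    moreover have "eaters R s x = {}"
      using \<open>x \<notin> items s\<close> top_item_in[OF profile ne] by (auto simp: eaters_def)
    ultimately show False using that by (simp add: stock)
  qed
  ultimately show ?thesis by (auto simp: consistent_def items_round)
qed

text \<open>If the item survives, the minimum in \<open>sum_consumed_eaters\<close> is the joint
  appetite and not the stock. No eater exceeds its own appetite, so equality of the sums forces
  equality for each of them.\<close>

lemma sated_if_remaining:
  assumes s: "consistent s" and ne: "items s \<noteq> {}"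
    and x: "best s j \<in> items (pre_round \<omega> R s)"
  shows "F j (elapsed (pre_round \<omega> R s) j) = 1"
proof -
  let ?x = "best s j"
  have "stock (pre_round \<omega> R s) ?x \<noteq> 0" using x items_round by blast
  then have "(\<Sum>k\<in>eaters R s ?x. consumed s k) \<noteq> stock s ?x"
    by (simp add: stock_round sum_alloc_round[OF s ne])
  then have "(\<Sum>k\<in>eaters R s ?x. consumed s k) = (\<Sum>k\<in>eaters R s ?x. 1 - F k (elapsed s k))"
    by (simp add: sum_consumed_eaters[OF s] min_def split: if_splits)
  then have "(\<Sum>k\<in>eaters R s ?x. (1 - F k (elapsed s k)) - consumed s k) = 0"
    by (simp add: sum_subtractf)
  moreover have "0 \<le> (1 - F k (elapsed s k)) - consumed s k" for k
    using F_le_1[of "elapsed s k + duration \<omega> R s (best s k)" k] s duration_nonneg[OF s]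
    by (simp add: consumed_def consistent_def)
  moreover have "j \<in> eaters R s ?x" by (simp add: eaters_def)
  ultimately have "(1 - F j (elapsed s j)) - consumed s j = 0"
    by (subst (asm) sum_nonneg_eq_0_iff) auto
  then show ?thesis by (simp add: consumed_def elapsed_round)
qed

text \<open>If no item were exhausted, all agents would be satisfied; then the total amount eaten would
  be the number of agents, which is the number of items, and nothing could be left.\<close>

lemma items_round_psubset:
  assumes s: "consistent s" and ne: "items s \<noteq> {}"
  shows "items (pre_round \<omega> R s) \<subset> items s"
proof (rule ccontr)
  assume "\<not> ?thesis"
  then have eq: "items (pre_round \<omega> R s) = items s" using items_round_subset by blast
  let ?s = "pre_round \<omega> R s"
  have s': "consistent ?s" by (rule consistent_round[OF s ne])
  have "F j (elapsed ?s j) = 1" for j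
    using sated_if_remaining[OF s ne] top_item_in[OF profile ne] eq by blast
  then have "(\<Sum>j\<in>UNIV. \<Sum>x\<in>UNIV. alloc ?s j x) = (\<Sum>j\<in>(UNIV::'a set). 1)"
    using s' by (simp add: consistent_def)
  also have "\<dots> = real CARD('b)" using card_eq by simp
  finally have total: "(\<Sum>j\<in>UNIV. \<Sum>x\<in>UNIV. alloc ?s j x) = real CARD('b)" .
  have "(\<Sum>x\<in>UNIV. stock ?s x) = (\<Sum>x\<in>UNIV. 1 - (\<Sum>j\<in>UNIV. alloc ?s j x))"
    using s' by (simp add: consistent_def)
  also have "\<dots> = real CARD('b) - (\<Sum>x\<in>UNIV. \<Sum>j\<in>UNIV. alloc ?s j x)"
    by (simp add: sum_subtractf)
  also have "\<dots> = 0" using total by (subst sum.swap) simp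
  moreover have "0 \<le> stock ?s x" for x using s' unfolding consistent_def by blast
  ultimately have "stock ?s x = 0" for x by (simp add: sum_nonneg_eq_0_iff)
  then show False using ne eq by (auto simp: items_round)
qed

section \<open>Iterated rounds and the outcome of the loop\<close>

definition state :: "nat \<Rightarrow> ('a, 'b) pre_state" where
  "state i = (pre_round \<omega> R ^^ i) pre_init"

lemma state_0: "state 0 = pre_init"
  by (simp add: state_def)

lemma state_Suc: "state (Suc i) = pre_round \<omega> R (state i)"
  by (simp add: state_def)

lemma consistent_init: "consistent pre_init"
  by (auto simp: consistent_def pre_init_def)

lemma items_state_antimono: "i \<le> i' \<Longrightarrow> items (state i') \<subseteq> items (state i)"
  by (rule lift_Suc_antimono_le[of "\<lambda>i. items (state i)"])
     (auto simp: state_Suc dest: items_round_subset[THEN subsetD])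

lemma consistent_state:
  assumes "\<forall>i'<i. items (state i') \<noteq> {}"
  shows "consistent (state i)"
  using assms
  by (induction i) (simp_all add: state_0 consistent_init state_Suc consistent_round)

lemma consistent_state_nonempty: "items (state i) \<noteq> {} \<Longrightarrow> consistent (state i)"
  using items_state_antimono by (intro consistent_state) (metis less_imp_le subset_empty)

lemma items_state_CARD: "items (state CARD('b)) = {}"
proof -
  have "card (items (state i)) \<le> CARD('b) - i" for i
  proof (induction i)
    case 0
    then show ?case by (simp add: card_mono)
  next
    case (Suc i)
    show ?case
    proof (cases "items (state i) = {}")
      case True
      then show ?thesis using items_state_antimono[of i "Suc i"] by simp
    next
      case False
      then have "items (state (Suc i)) \<subset> items (state i)"
        using items_round_psubset consistent_state_nonempty by (simp add: state_Suc)
      then have "card (items (state (Suc i))) < card (items (state i))"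
        by (intro psubset_card_mono) auto
      then show ?thesis using Suc by linarith
    qed
  qed
  from this[of "CARD('b)"] show ?thesis by simp
qed

text \<open>\<open>i\<close> may lie beyond the end of the loop, since rounds without items hand out
  nothing. Elapsed times are under no control in such rounds, so only \<open>alloc\<close> and
  \<open>items\<close> are traced through them.\<close>

lemma PRE_eq_alloc:
  assumes "items (state i) = {}"
  shows "PRE \<omega> R = alloc (state i)"
proof -
  let ?W = "while (\<lambda>s. items s \<noteq> {}) (pre_round \<omega> R)"
  have stop: "alloc ((pre_round \<omega> R ^^ k) s) = alloc s \<and> items ((pre_round \<omega> R ^^ k) s) = {}"
    if "items s = {}" for k s
    using that
    by (induction k) (auto simp: fun_eq_iff alloc_round_notin dest: items_round_subset[THEN subsetD])
  have "alloc (?W s) = alloc ((pre_round \<omega> R ^^ k) s)" if "items ((pre_round \<omega> R ^^ k) s) = {}" for k s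
    using that
  proof (induction k arbitrary: s)
    case 0
    then show ?case by (simp add: while_unfold)
  next
    case (Suc k)
    show ?case
    proof (cases "items s = {}")
      case True
      then show ?thesis using stop[OF True, of "Suc k"] by (simp add: while_unfold)
    next
      case False
      then have "?W s = ?W (pre_round \<omega> R s)" by (simp add: while_unfold)
      then show ?thesis using Suc by (simp add: funpow_swap1)
    qed
  qed
  from this[of i pre_init] show ?thesis using assms by (simp add: PRE_def state_def)
qed

text \<open>Once \<open>x\<close> is gone or \<open>j\<close> is satisfied, the share of
  \<open>x\<close> held by \<open>j\<close> is final. The second conjunct carries this alternative
  through the induction.\<close>

lemma alloc_state_settled:
  assumes "i \<le> i'"
    and "x \<in> items (state i) \<Longrightarrow> F j (elapsed (state i) j) = 1"
  shows "alloc (state i') j x = alloc (state i) j x \<and>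
    (x \<in> items (state i') \<longrightarrow> F j (elapsed (state i') j) = 1)"
  using assms(1)
proof (induction i' rule: dec_induct)
  case base
  then show ?case using assms(2) by simp
next
  case (step m)
  show ?case
  proof (cases "x \<in> items (state m)")
    case True
    then have c: "consistent (state m)" and ne: "items (state m) \<noteq> {}"
      using consistent_state_nonempty by auto
    have sated: "F j (elapsed (state m) j) = 1" using True step.IH by blast
    have "0 \<le> elapsed (state m) j" using c unfolding consistent_def by blast
    with sated have "F j (elapsed (state m) j + duration \<omega> R (state m) (best (state m) j)) = 1"
      by (rule F_sated) (simp add: duration_nonneg[OF c])
    then show ?thesis
      using step.IH sated by (simp add: state_Suc alloc_round[OF c ne] consumed_def elapsed_round)
  next
    case False
    then show ?thesis
      using step.IH items_round_subset[of "state m"] by (auto simp: state_Suc alloc_round_notin)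
  qed
qed

text \<open>The sets \<open>remaining R P r\<close> are indexed from 1, the states from 0.\<close>

lemma state_eq_acquired:
  assumes P: "P = PRE \<omega> R"
    and "\<forall>i'<i. items (state i') \<noteq> {}"
  shows "alloc (state i) = acquired R P (Suc i)" "items (state i) = remaining R P (Suc i)"
proof -
  have items_if: "items (state i) = remaining R P (Suc i)"
    if "\<forall>i'<i. items (state i') \<noteq> {}" "alloc (state i) = acquired R P (Suc i)" for i
    by (simp add: items_consistent[OF consistent_state[OF that(1)]] remaining_eq_acquired that(2))
  have "alloc (state i) = acquired R P (Suc i)" using assms(2)
  proof (induction i)
    case 0
    then show ?case by (simp add: fun_eq_iff state_0 pre_init_def)
  next
    case (Suc i)
    then have IH: "alloc (state i) = acquired R P (Suc i)" and ne: "items (state i) \<noteq> {}" by auto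
    have it: "items (state i) = remaining R P (Suc i)" using items_if IH Suc.prems by simp
    have c: "consistent (state i)" using consistent_state_nonempty ne by simp
    have "alloc (state (Suc i)) j x = P j x" if "x = best (state i) j" for j x
    proof -
      \<comment> \<open>The index is late enough for the loop to have ended, and not before
        \<open>Suc i\<close>, so the current allocation can be compared with the outcome.\<close>
      have PT: "P = alloc (state (max (Suc i) CARD('b)))"
        unfolding P
        using items_state_CARD items_state_antimono[of "CARD('b)" "max (Suc i) CARD('b)"]
        by (intro PRE_eq_alloc) auto
      \<comment> \<open>Either the item is used up in this round or its eater is now satisfied; in
        both cases the share no longer changes.\<close>
      have "x \<in> items (state (Suc i)) \<Longrightarrow> F j (elapsed (state (Suc i)) j) = 1"
        using sated_if_remaining[OF c ne] that by (simp add: state_Suc)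
      then show ?thesis
        unfolding PT using alloc_state_settled[of "Suc i" "max (Suc i) CARD('b)" x j] by auto
    qed
    moreover have "alloc (state (Suc i)) j x = alloc (state i) j x" if "x \<noteq> best (state i) j" for j x
      using that by (simp add: state_Suc alloc_round_other)
    moreover have "best (state i) j \<in> items (state i)" for j
      by (rule top_item_in[OF profile ne])
    ultimately have "alloc (state (Suc i)) j x = acquired R P (Suc (Suc i)) j x" for j x
      by (cases "x = best (state i) j") (auto simp: acquired_Suc[of R P "Suc i"] it[symmetric] IH)
    then show ?case by (simp add: fun_eq_iff)
  qed
  then show "alloc (state i) = acquired R P (Suc i)" "items (state i) = remaining R P (Suc i)"
    using items_if assms(2) by auto
qed

text \<open>If \<open>x\<close> outlives a round in which \<open>j\<close> ate it, \<open>j\<close>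
  is satisfied after that round. Until then \<open>x\<close> was on offer, so whatever
  \<open>j\<close> ate is \<open>x\<close> or better, and the upper set of \<open>x\<close> holds a
  full unit.\<close>

lemma PRE_ea_FERI:
  assumes "random_assignment (PRE \<omega> R)"
  shows "ea_FERI R (PRE \<omega> R)"
  unfolding ea_FERI_def
proof (intro allI ballI impI)
  define P where "P = PRE \<omega> R"
  have nonneg: "0 \<le> P j x" and row: "(\<Sum>x\<in>UNIV. P j x) = 1" for j x
    using assms by (auto simp: P_def random_assignment_def)
  fix r x j
  assume "1 \<le> r" "x \<in> remaining R (PRE \<omega> R) r" "\<exists>r'<r. j \<in> eager R (PRE \<omega> R) r' x"
  then obtain r' where x: "x \<in> remaining R P r" and r': "r' < r" "j \<in> eager R P r' x"
    unfolding P_def by blast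
  from r'(2) obtain i where i: "r' = Suc i" by (cases r') auto
  have x_in: "x \<in> remaining R P (Suc m)" if "m < r" for m
    using remaining_antimono[where P = P and R = R, OF nonneg, of "Suc m" r] x that by auto
  \<comment> \<open>Identifying a state with its round requires all earlier states to be nonempty,
    hence the strong induction; \<open>x\<close> itself witnesses nonemptiness.\<close>
  have nonempty: "items (state m) \<noteq> {}" if "m < r" for m
    using that
  proof (induction m rule: less_induct)
    case (less m)
    then have "items (state m) = remaining R P (Suc m)"
      by (intro state_eq_acquired(2)) (auto simp: P_def)
    then show ?case using x_in less.prems by auto
  qed
  have st: "alloc (state m) = acquired R P (Suc m)" "items (state m) = remaining R P (Suc m)"
    if "m < r" for m
    using state_eq_acquired[of P m] nonempty that by (auto simp: P_def)
  have Suc_i: "Suc i < r" and ir: "i < r" using r' i by auto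
  have top: "x = best (state i) j"
    using r'(2) st(2)[OF ir] by (auto simp: i eager.simps split: if_splits)
  have "x \<in> items (state (Suc i))"
    using x_in[OF Suc_i] by (simp add: st(2)[OF Suc_i])
  then have "F j (elapsed (state (Suc i)) j) = 1"
    using sated_if_remaining[of "state i" j] consistent_state_nonempty nonempty[OF ir]
    by (simp add: state_Suc top)
  moreover have "consistent (state (Suc i))"
    using consistent_state_nonempty nonempty[OF Suc_i] by simp
  ultimately have "(\<Sum>y\<in>UNIV. acquired R P (Suc (Suc i)) j y) = 1"
    by (simp add: consistent_def st(1)[OF Suc_i, symmetric])
  moreover have "acquired R P (Suc (Suc i)) j y = 0" if "y \<notin> upper_set (R j) x" for y
  proof (rule ccontr)
    assume "acquired R P (Suc (Suc i)) j y \<noteq> 0"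
    then obtain m where "m < Suc (Suc i)" "j \<in> eager R P m y"
      by (auto simp: acquired_def split: if_splits)
    then obtain k where k: "k \<le> i" "j \<in> eager R P (Suc k) y"
      by (cases m) (auto simp: less_Suc_eq_le)
    then have "y = best (state k) j" using st(2)[of k] ir by (auto simp: eager.simps split: if_splits)
    moreover have "x \<in> items (state k)"
      using items_state_antimono[OF k(1)] top_item_in[OF profile nonempty[OF ir], of j]
      by (auto simp: top)
    ultimately show False
      using top_item_best[OF profile, of "items (state k)" x j] that by (auto simp: upper_set_def)
  qed
  ultimately have "(\<Sum>y\<in>upper_set (R j) x. acquired R P (Suc (Suc i)) j y) = 1"
    by (subst (asm) sum.mono_neutral_right[of UNIV "upper_set (R j) x"]) auto
  moreover have "(\<Sum>y\<in>upper_set (R j) x. acquired R P (Suc (Suc i)) j y) \<le> (\<Sum>y\<in>upper_set (R j) x. P j y)"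
    by (intro sum_mono acquired_le nonneg)
  moreover have "(\<Sum>y\<in>upper_set (R j) x. P j y) \<le> (\<Sum>y\<in>UNIV. P j y)"
    by (intro sum_mono2) (auto simp: nonneg)
  ultimately show "(\<Sum>y\<in>upper_set (R j) x. PRE \<omega> R j y) = 1"
    using row[of j] by (simp add: P_def)
qed

end

section \<open>Eating speeds for an assignment that satisfies ea-FERI\<close>

text \<open>Slots have length \<open>1 / n\<close>, so the height \<open>n * q r\<close> makes
  \<open>q r\<close> the amount eaten in slot \<open>r\<close>. The closed slots overlap at grid
  points, which no integral notices.\<close>

definition step_speed :: "nat \<Rightarrow> (nat \<Rightarrow> real) \<Rightarrow> real \<Rightarrow> real" where
  "step_speed n q t = (\<Sum>r<n. if t \<in> {r / n..Suc r / n} then n * q r else 0)"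

text \<open>Slots before \<open>i\<close> contribute in full, slot \<open>i\<close> in proportion to
  \<open>\<rho>\<close>, and later slots meet the interval in at most one point.\<close>

lemma step_speed_integral:
  assumes "i < n" "0 \<le> \<rho>" "\<rho> \<le> 1 / n"
  shows "integral {0..i / n + \<rho>} (step_speed n q) = (\<Sum>r<i. q r) + n * q i * \<rho>"
proof -
  let ?t = "i / n + \<rho>"
  have n: "0 < real n" using assms by simp
  let ?f = "\<lambda>r t. if t \<in> {r / n..Suc r / n} then n * q r else (0::real)"
  have Int: "{0..?t} \<inter> {real r / n..Suc r / n} = {r / n..min ?t (Suc r / n)}" for r :: nat
    using n by (auto intro: order_trans[of 0 "r / n"])
  have const: "integral {a..u} (\<lambda>t. v) = v * (if a \<le> u then u - a else 0)" for a u v :: real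
    by simp
  have "?f r integrable_on {0..?t}" for r
    unfolding integrable_restrict_Int by (subst Int_commute) (simp only: Int integrable_const_ivl)
  then have "integral {0..?t} (step_speed n q) = (\<Sum>r<n. integral {0..?t} (?f r))"
    unfolding step_speed_def by (intro integral_sum) auto
  also have "\<dots> = (\<Sum>r<n. if r < i then q r else if r = i then n * q i * \<rho> else 0)"
  proof (intro sum.cong refl)
    fix r
    have "integral {0..?t} (?f r) = integral ({0..?t} \<inter> {r / n..Suc r / n}) (\<lambda>_. n * q r)"
      by (subst Int_commute) (rule integral_restrict_Int)
    also have "\<dots> = n * q r * (if r / n \<le> min ?t (Suc r / n) then min ?t (Suc r / n) - r / n else 0)"
      by (subst Int) (rule const)
    also have "\<dots> = (if r < i then q r else if r = i then n * q i * \<rho> else 0)"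
    proof -
      consider "r < i" | "r = i" | "i < r" by linarith
      then show ?thesis
      proof cases
        case 1
        then have "Suc r / n \<le> i / n" using n by (intro divide_right_mono) auto
        then have "min ?t (Suc r / n) = Suc r / n" using assms by simp
        moreover have "r / n \<le> Suc r / n" "Suc r / n - r / n = 1 / n"
          using n by (auto simp: divide_right_mono add_divide_distrib)
        ultimately show ?thesis using 1 n by (simp del: of_nat_Suc)
      next
        case 2
        then have "min ?t (Suc r / n) = ?t" using assms by (simp add: add_divide_distrib)
        then show ?thesis using 2 assms by simp
      next
        case 3
        then have "Suc i / n \<le> r / n" using n by (intro divide_right_mono) auto
        then have "?t \<le> r / n" using assms by (simp add: add_divide_distrib)
        then show ?thesis using 3 by (auto simp: min_def)
      qed
    qed
    finally show "integral {0..?t} (?f r) = (if r < i then q r else if r = i then n * q i * \<rho> else 0)" .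
  qed
  also have "\<dots> = (\<Sum>r<Suc i. if r < i then q r else if r = i then n * q i * \<rho> else 0)"
    using assms(1) by (intro sum.mono_neutral_right) auto
  finally show ?thesis by simp
qed

text \<open>A positive grid point is treated as the end of the slot before it, because
  \<open>i = n\<close> begins no slot.\<close>

lemma step_speed_integral_grid:
  assumes "i \<le> n"
  shows "integral {0..i / n} (step_speed n q) = (\<Sum>r<i. q r)"
proof (cases i)
  case (Suc k)
  then show ?thesis
    using step_speed_integral[of k n "1 / n" q] assms by (simp add: add_divide_distrib add.commute)
qed simp

lemma eating_speeds_step_speed:
  assumes "0 < n" "\<And>j r. 0 \<le> q j r" "\<And>j. (\<Sum>r<n. q j r) = 1"
  shows "eating_speeds (\<lambda>j. step_speed n (q j))"
  unfolding eating_speeds_def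
proof (intro allI conjI impI)
  fix j
  have "integrable lebesgue (\<lambda>t. indicator {r / n..Suc r / n} t *\<^sub>R (n * q j r))" for r :: nat
    by (intro integrable_indicator) (auto simp: emeasure_lborel_Icc_eq)
  then have "integrable lebesgue (\<lambda>t. \<Sum>r<n. indicator {r / n..Suc r / n} t *\<^sub>R (n * q j r))"
    by (intro Bochner_Integration.integrable_sum)
  moreover have "(\<lambda>t. \<Sum>r<n. indicator {r / n..Suc r / n} t *\<^sub>R (n * q j r)) = step_speed n (q j)"
    unfolding step_speed_def by (intro ext sum.cong refl) (simp split: split_indicator)
  ultimately have "set_integrable lebesgue UNIV (step_speed n (q j))"
    by (simp add: set_integrable_def)
  then have int: "set_integrable lebesgue S (step_speed n (q j))" if "S \<in> sets lebesgue" for S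
    by (rule set_integrable_subset) (use that in auto)
  show "set_integrable lebesgue {0..} (step_speed n (q j))" by (rule int) simp
  have "(LINT t=0..1|lebesgue. step_speed n (q j) t) = integral {0<..<1} (step_speed n (q j))"
    unfolding interval_lebesgue_integral_def zero_ereal_def one_ereal_def
    by (simp add: set_lebesgue_integral_eq_integral(2)[OF int])
  also have "\<dots> = integral {0..n / n} (step_speed n (q j))"
    using assms(1) by (simp add: integral_open_interval_real)
  finally show "(LINT t=0..1|lebesgue. step_speed n (q j) t) = 1"
    using assms by (simp only: step_speed_integral_grid)
next
  fix j t
  show "0 \<le> step_speed n (q j) t"
    using assms by (auto simp: step_speed_def intro!: sum_nonneg)
next
  fix j and t :: real
  assume "1 < t"
  have "t \<notin> {real r / n..Suc r / n}" if "r < n" for r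
  proof -
    have "Suc r / n \<le> 1" using that by simp
    then show ?thesis using \<open>1 < t\<close> by simp
  qed
  then show "step_speed n (q j) t = 0" unfolding step_speed_def by (intro sum.neutral) auto
qed

section \<open>Shares acquired under ea-FERI\<close>

locale feri_assignment =
  fixes R :: "'a::finite \<Rightarrow> 'b::finite rel" and P :: "'a \<Rightarrow> 'b \<Rightarrow> real"
  assumes card_eq: "CARD('a) = CARD('b)"
    and profile: "preference_profile R"
    and assignment: "random_assignment P"
    and feri: "ea_FERI R P"
begin

abbreviation M :: "nat \<Rightarrow> 'b set" where
  "M i \<equiv> remaining R P (Suc i)"

abbreviation A :: "nat \<Rightarrow> 'a \<Rightarrow> 'b \<Rightarrow> real" where
  "A i \<equiv> acquired R P (Suc i)"

lemma P_nonneg: "0 \<le> P j x" and row: "(\<Sum>x\<in>UNIV. P j x) = 1" and column: "(\<Sum>j\<in>UNIV. P j x) = 1"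
  using assignment by (auto simp: random_assignment_def)

lemma M_antimono: "i \<le> i' \<Longrightarrow> M i' \<subseteq> M i"
  using remaining_antimono[where P = P and R = R, OF P_nonneg] by simp

lemma M_eq: "M i = {x. (\<Sum>j\<in>UNIV. A i j x) < 1}"
  by (rule remaining_eq_acquired) simp

lemma A_Suc: "A (Suc i) j x = (if x \<in> M i \<and> top_item R j (M i) = x then P j x else A i j x)"
  by (rule acquired_Suc)

lemma A_mono: "i \<le> i' \<Longrightarrow> A i j x \<le> A i' j x"
  by (rule acquired_mono) (auto simp: P_nonneg)

lemma A_le: "A i j x \<le> P j x" and A_nonneg: "0 \<le> A i j x"
  using acquired_le[where P = P, OF P_nonneg] by auto

lemma A_le_1: "(\<Sum>x\<in>UNIV. A i j x) \<le> 1" "(\<Sum>j\<in>UNIV. A i j x) \<le> 1"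
  using sum_mono[of UNIV "A i j" "P j"] sum_mono[of UNIV "\<lambda>j. A i j x" "\<lambda>j. P j x"]
  by (simp_all add: row column A_le)

text \<open>The acquired column already sums to 1, as does the column of \<open>P\<close>, which
  dominates it entry by entry.\<close>

lemma acquired_all:
  assumes "x \<notin> M i"
  shows "A i j x = P j x"
proof -
  have "(\<Sum>k\<in>UNIV. P k x - A i k x) = 0"
    using assms A_le_1(2)[of i x] by (simp add: sum_subtractf M_eq column)
  then show ?thesis by (subst (asm) sum_nonneg_eq_0_iff) (auto simp: A_le)
qed

text \<open>Every item that \<open>j\<close> prefers to \<open>x\<close> was gone by the round in which \<open>x\<close> was best for \<open>j\<close>, hence
  \<open>j\<close> has already acquired its whole share of the upper set in which FERI puts all of it.\<close>

lemma acquired_sum_eq_1: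
  assumes "i < i'" "x = top_item R j (M i)" "x \<in> M i'"
  shows "(\<Sum>y\<in>UNIV. A i' j y) = 1"
proof -
  have x: "x \<in> M i" using M_antimono[of i i'] assms by auto
  then have j: "j \<in> eager R P (Suc i) x" using assms(2) by (simp add: eager.simps)
  then have "(\<Sum>y\<in>upper_set (R j) x. P j y) = 1"
    using feri assms(1,3) unfolding ea_FERI_def by (metis Suc_less_eq le_add1 plus_1_eq_Suc)
  moreover have "A i' j y = P j y" if "y \<in> upper_set (R j) x" for y
  proof (cases "y = x")
    case True
    then show ?thesis using j assms(1) by (auto simp: acquired_def intro!: bexI[of _ "Suc i"])
  next
    case False
    then have "y \<notin> M i"
      using that preferred_to_top_item_notin[OF profile, of y j "M i"] assms(2)
      by (auto simp: upper_set_def)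
    then have "A i j y = P j y" by (rule acquired_all)
    then show ?thesis using A_mono[of i i' j y] A_le[of i' j y] assms(1) by simp
  qed
  ultimately have "1 = (\<Sum>y\<in>upper_set (R j) x. A i' j y)" by simp
  also have "\<dots> \<le> (\<Sum>y\<in>UNIV. A i' j y)" by (intro sum_mono2) (auto simp: A_nonneg)
  finally show ?thesis using A_le_1(1)[of i' j] by simp
qed

lemma M_Suc_psubset:
  assumes ne: "M i \<noteq> {}"
  shows "M (Suc i) \<subset> M i"
proof (rule ccontr)
  assume "\<not> ?thesis"
  then have eq: "M (Suc i) = M i" using M_antimono[of i "Suc i"] by auto
  have "(\<Sum>y\<in>UNIV. A (Suc i) j y) = 1" for j
    using top_item_in[OF profile ne, of j] eq by (intro acquired_sum_eq_1[OF lessI refl]) simp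
  then have "real CARD('b) = (\<Sum>j\<in>UNIV. \<Sum>y\<in>UNIV. A (Suc i) j y)" using card_eq by simp
  also have "\<dots> = (\<Sum>y\<in>UNIV. \<Sum>j\<in>UNIV. A (Suc i) j y)" by (rule sum.swap)
  also have "\<dots> < (\<Sum>y\<in>(UNIV::'b set). 1)"
  proof (rule sum_strict_mono_ex1)
    show "\<exists>y\<in>UNIV. (\<Sum>j\<in>UNIV. A (Suc i) j y) < 1" using ne eq M_eq[of "Suc i"] by auto
  qed (auto simp: A_le_1)
  finally show False by simp
qed

lemma M_CARD: "M CARD('b) = {}"
proof -
  have "card (M i) \<le> CARD('b) - i" for i
  proof (induction i)
    case 0
    then show ?case by (simp add: card_mono)
  next
    case (Suc i)
    show ?case
    proof (cases "M i = {}")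
      case True
      then show ?thesis using M_antimono[of i "Suc i"] by simp
    next
      case False
      then have "card (M (Suc i)) < card (M i)"
        using M_Suc_psubset by (intro psubset_card_mono) auto
      then show ?thesis using Suc by linarith
    qed
  qed
  from this[of "CARD('b)"] show ?thesis by simp
qed

section \<open>The slot schedule and its run\<close>

definition q :: "'a \<Rightarrow> nat \<Rightarrow> real" where
  "q j i = (\<Sum>x\<in>UNIV. A (Suc i) j x - A i j x)"

lemma q_nonneg: "0 \<le> q j i"
  unfolding q_def by (intro sum_nonneg) (simp add: A_mono)

lemma sum_q: "(\<Sum>r<i. q j r) = (\<Sum>x\<in>UNIV. A i j x)"
  by (induction i) (simp_all add: q_def sum_subtractf)

text \<open>Only the entry of the current best item can change in a round, so all of
  \<open>q j i\<close> sits there; it is 0 if \<open>j\<close> was eager for that item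
  before.\<close>

lemma A_Suc_q:
  assumes "M i \<noteq> {}"
  shows "A (Suc i) j x = A i j x + (if x = top_item R j (M i) then q j i else 0)"
proof -
  have other: "A (Suc i) j y = A i j y" if "y \<noteq> top_item R j (M i)" for y
    using that by (auto simp: A_Suc)
  have "q j i = (\<Sum>y\<in>{top_item R j (M i)}. A (Suc i) j y - A i j y)"
    unfolding q_def using other by (intro sum.mono_neutral_right) auto
  then show ?thesis using other by auto
qed

definition \<omega> :: "'a \<Rightarrow> real \<Rightarrow> real" where
  "\<omega> j = step_speed CARD('b) (q j)"

lemma eating_speeds_\<omega>: "eating_speeds \<omega>"
proof -
  \<comment> \<open>After \<open>CARD('b)\<close> rounds no item remains, so the acquired shares are
    all of \<open>P\<close> and the row sums to 1.\<close>
  have "(\<Sum>r<CARD('b). q j r) = 1" for j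
    using M_CARD by (simp add: sum_q acquired_all row)
  then show ?thesis
    unfolding \<omega>_def by (intro eating_speeds_step_speed) (auto simp: q_nonneg)
qed

sublocale pre_run R \<omega>
  by unfold_locales (rule card_eq profile eating_speeds_\<omega>)+

lemma F_slot:
  assumes "i < CARD('b)" "0 \<le> \<rho>" "\<rho> \<le> 1 / CARD('b)"
  shows "F j (i / CARD('b) + \<rho>) = F j (i / CARD('b)) + CARD('b) * q j i * \<rho>"
  unfolding F_def \<omega>_def using assms by (simp add: step_speed_integral step_speed_integral_grid)

lemma F_grid: "i \<le> CARD('b) \<Longrightarrow> F j (i / CARD('b)) = (\<Sum>x\<in>UNIV. A i j x)"
  by (simp add: F_def \<omega>_def step_speed_integral_grid sum_q)

text \<open>The elapsed time of a satisfied agent may lag behind the grid, since a round in which an item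
  has only satisfied eaters has duration 0.\<close>

definition on_schedule :: "nat \<Rightarrow> ('a, 'b) pre_state \<Rightarrow> bool" where
  "on_schedule i s \<longleftrightarrow> items s = M i \<and> alloc s = A i \<and>
    (\<forall>j. F j (elapsed s j) = F j (i / CARD('b)) \<and> (elapsed s j = i / CARD('b) \<or> F j (i / CARD('b)) = 1))"

text \<open>Within a slot the eaters of \<open>x\<close> jointly eat at constant speed, and a full
  slot yields \<open>c\<close>. Either \<open>x\<close> leaves and \<open>c\<close> is its stock, or
  \<open>x\<close> stays and ea-FERI satisfies all its eaters by the end of the slot. So the round
  lasts exactly one slot if some eater is unsatisfied.\<close>

lemma elapsed_round_on_schedule:
  assumes s: "consistent s" and i: "i < CARD('b)" and ne: "M i \<noteq> {}" and sched: "on_schedule i s"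
  shows "F j (elapsed (pre_round \<omega> R s) j) = F j (Suc i / CARD('b)) \<and>
    (elapsed (pre_round \<omega> R s) j = Suc i / CARD('b) \<or> F j (Suc i / CARD('b)) = 1)"
proof -
  have its: "items s = M i" and al: "alloc s = A i"
    and Ft: "\<And>k. F k (elapsed s k) = F k (i / CARD('b))"
    and t: "\<And>k. elapsed s k = i / CARD('b) \<or> F k (i / CARD('b)) = 1"
    using sched by (auto simp: on_schedule_def)
  have t0: "0 \<le> elapsed s k" for k using s by (simp add: consistent_def)
  define x where "x = best s j"
  define N where "N = eaters R s x"
  define d where "d = duration \<omega> R s x"
  define c where "c = (\<Sum>k\<in>N. q k i)"
  have n0: "0 < real CARD('b)" by simp
  have jN: "j \<in> N" by (simp add: N_def eaters_def x_def)
  have xM: "x \<in> M i" using top_item_in[OF profile ne] by (simp add: x_def its)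
  have top: "top_item R k (M i) = x" if "k \<in> N" for k
    using that by (simp add: N_def eaters_def its)
  have grid: "Suc i / CARD('b) = i / CARD('b) + 1 / CARD('b)" by (simp add: add_divide_distrib)
  have FSuc: "F k (Suc i / CARD('b)) = F k (i / CARD('b)) + q k i" for k
    unfolding grid using i by (simp add: F_slot)
  have sated_step: "F k (Suc i / CARD('b)) = 1 \<and> q k i = 0" if "F k (i / CARD('b)) = 1" for k
  proof -
    have "F k (Suc i / CARD('b)) = 1" using that by (rule F_sated) (auto simp: divide_right_mono)
    then show ?thesis using FSuc[of k] that by simp
  qed
  \<comment> \<open>An agent whose time is off the grid is already satisfied, so both sides are
    0.\<close>
  have slot: "F k (elapsed s k + \<rho>) - F k (elapsed s k) = CARD('b) * q k i * \<rho>"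
    if "0 \<le> \<rho>" "\<rho> \<le> 1 / CARD('b)" for k \<rho>
  proof (cases "elapsed s k = i / CARD('b)")
    case True
    then show ?thesis using F_slot[OF i that, of k] by simp
  next
    case False
    then have "F k (i / CARD('b)) = 1" using t by blast
    then show ?thesis using sated_step[of k] F_sated[of k "elapsed s k" "elapsed s k + \<rho>"] Ft t0 that by simp
  qed
  have g: "(\<Sum>k\<in>N. F k (elapsed s k + \<rho>) - F k (elapsed s k)) = CARD('b) * c * \<rho>"
    if "0 \<le> \<rho>" "\<rho> \<le> 1 / CARD('b)" for \<rho>
    using slot[OF that] by (simp add: c_def sum_distrib_left sum_distrib_right)
  have "(\<Sum>k\<in>UNIV. A (Suc i) k x) = (\<Sum>k\<in>UNIV. A i k x) + c"
    by (simp add: A_Suc_q[OF ne] sum.distrib c_def N_def eaters_def its sum.If_cases eq_commute)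
  then have stock: "stock s x = 1 - (\<Sum>k\<in>UNIV. A (Suc i) k x) + c"
    using s by (simp add: consistent_def al)
  then have c_le: "c \<le> stock s x" using A_le_1(2)[of "Suc i" x] by simp
  have exhausted: "stock s x = c" if "x \<notin> M (Suc i)"
    using that stock by (simp add: acquired_all column)
  have sated: "F k (Suc i / CARD('b)) = 1" if "x \<in> M (Suc i)" "k \<in> N" for k
    using acquired_sum_eq_1[of i "Suc i" x k] that top[OF that(2)] i
    by (simp add: F_grid del: of_nat_Suc)
  have d0: "0 \<le> d" unfolding d_def by (rule duration_nonneg[OF s])
  have goal: "F k (elapsed s k + d) = F k (Suc i / CARD('b)) \<and>
    (elapsed s k + d = Suc i / CARD('b) \<or> F k (Suc i / CARD('b)) = 1)" if k: "k \<in> N" for k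
  proof (cases "F k (i / CARD('b)) = 1")
    case True
    then show ?thesis
      using sated_step[OF True] F_sated[of k "elapsed s k" "elapsed s k + d"] Ft t0 d0 by simp
  next
    case unsated: False
    have "stock s x = 1 - (\<Sum>k\<in>UNIV. A i k x)"
      using s unfolding consistent_def al by blast
    then have "0 < stock s x" using xM by (simp add: M_eq)
    \<comment> \<open>If the eaters acquired nothing in this slot, \<open>x\<close> would remain and
      ea-FERI would make \<open>k\<close> satisfied already at the start of the slot.\<close>
    have "c \<noteq> 0"
    proof
      assume "c = 0"
      then have "x \<in> M (Suc i)" using exhausted \<open>0 < stock s x\<close> by auto
      moreover have "q k i = 0"
        using \<open>c = 0\<close> k unfolding c_def by (subst (asm) sum_nonneg_eq_0_iff) (auto simp: q_nonneg)
      ultimately show False using unsated sated[OF _ k] FSuc[of k] by simp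
    qed
    moreover have "0 \<le> c" unfolding c_def by (intro sum_nonneg q_nonneg)
    ultimately have c0: "0 < c" by simp
    have n1: "1 / real CARD('b) \<le> 1" using i by simp
    have g1: "(\<Sum>k\<in>N. F k (elapsed s k + 1 / CARD('b)) - F k (elapsed s k)) = c"
      using g[of "1 / CARD('b)"] by simp
    \<comment> \<open>The slot length is itself a stopping time, by satisfaction or by exhaustion
      according to whether \<open>x\<close> remains.\<close>
    have "d \<le> 1 / CARD('b)"
    proof (cases "x \<in> M (Suc i)")
      case True
      have "1 - F k (elapsed s k) = q k i" if "k \<in> N" for k
        using sated[OF True that] FSuc[of k] by (simp add: Ft del: of_nat_Suc)
      then have "(\<Sum>k\<in>N. 1 - F k (elapsed s k)) = (\<Sum>k\<in>N. q k i)"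
        by (intro sum.cong refl)
      then show ?thesis
        unfolding d_def using g1 n1 unfolding N_def c_def
        by (intro duration_le_sated[OF s]) auto
    next
      case False
      then show ?thesis
        unfolding d_def using g1 exhausted unfolding N_def
        by (intro duration_le_exhausted[OF s]) auto
    qed
    \<comment> \<open>The amount eaten is the smaller of stock and joint appetite, both at least
      \<open>c\<close>; at speed \<open>CARD('b) * c\<close> this takes a whole slot.\<close>
    moreover have "1 / CARD('b) \<le> d"
    proof -
      have "c \<le> (\<Sum>k\<in>N. 1 - F k (elapsed s k))"
        unfolding g1[symmetric] using t0 by (intro sum_mono diff_right_mono F_le_1) auto
      then have "c \<le> (\<Sum>k\<in>N. F k (elapsed s k + d) - F k (elapsed s k))"
        using duration_amount[OF s, of x] c_le unfolding N_def d_def by simp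
      also have "\<dots> = CARD('b) * c * d" using g d0 \<open>d \<le> 1 / CARD('b)\<close> by simp
      finally show ?thesis using c0 n0 by (simp add: field_simps)
    qed
    ultimately have "d = 1 / CARD('b)" by simp
    moreover have "elapsed s k = i / CARD('b)" using t unsated by blast
    ultimately show ?thesis by (simp only: grid simp_thms)
  qed
  from goal[OF jN] show ?thesis by (simp add: elapsed_round d_def x_def)
qed

text \<open>\<open>F\<close> grows by \<open>q j i\<close> between consecutive grid points, so the
  round hands out exactly what \<open>A\<close> gains; the items follow from the allocation.\<close>

lemma on_schedule_round:
  assumes s: "consistent s" and i: "i < CARD('b)" and ne: "M i \<noteq> {}" and sched: "on_schedule i s"
  shows "on_schedule (Suc i) (pre_round \<omega> R s)"
proof -
  note el = elapsed_round_on_schedule[OF assms]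
  have its: "items s = M i" and al: "alloc s = A i"
    and Ft: "\<And>k. F k (elapsed s k) = F k (i / CARD('b))"
    using sched by (auto simp: on_schedule_def)
  have ne': "items s \<noteq> {}" using ne its by simp
  have c: "consumed s j = q j i" for j
  proof -
    have "F j (i / CARD('b)) = (\<Sum>r<i. q j r)" "F j (Suc i / CARD('b)) = (\<Sum>r<Suc i. q j r)"
      using F_grid[of i j] F_grid[of "Suc i" j] i by (simp_all only: sum_q less_imp_le Suc_leI)
    then have "F j (Suc i / CARD('b)) - F j (i / CARD('b)) = q j i" by simp
    then show ?thesis
      using conjunct1[OF el, of j] unfolding consumed_def elapsed_round Ft by (simp only:)
  qed
  have "alloc (pre_round \<omega> R s) j x = A (Suc i) j x" for j x
    unfolding alloc_round[OF s ne'] A_Suc_q[OF ne] c its al ..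
  then have al': "alloc (pre_round \<omega> R s) = A (Suc i)" by blast
  have "consistent (pre_round \<omega> R s)" by (rule consistent_round[OF s ne'])
  then have "items (pre_round \<omega> R s) = M (Suc i)"
    by (simp add: items_consistent al' M_eq)
  then show ?thesis using al' el by (simp add: on_schedule_def)
qed

lemma on_schedule_state:
  assumes "\<forall>i'<i. items (state i') \<noteq> {}" "i \<le> CARD('b)"
  shows "on_schedule i (state i)"
  using assms
proof (induction i)
  case 0
  then show ?case
    by (auto simp: on_schedule_def state_0 pre_init_def fun_eq_iff M_eq)
next
  case (Suc i)
  then have "on_schedule i (state i)" "items (state i) \<noteq> {}" by auto
  moreover have "M i \<noteq> {}" using calculation by (simp add: on_schedule_def)
  ultimately show ?case
    unfolding state_Suc using Suc.prems consistent_state_nonempty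
    by (intro on_schedule_round) auto
qed

lemma PRE_\<omega>: "PRE \<omega> R = P"
proof -
  \<comment> \<open>The first empty state is taken because the schedule is established only while
    all earlier states are nonempty. There \<open>M i\<close> is empty, so \<open>A i\<close> is all
    of \<open>P\<close>.\<close>
  define i where "i = (LEAST i. items (state i) = {})"
  have e: "items (state i) = {}" unfolding i_def by (rule LeastI) (rule items_state_CARD)
  have "i \<le> CARD('b)" unfolding i_def by (rule Least_le) (rule items_state_CARD)
  moreover have "\<forall>i'<i. items (state i') \<noteq> {}" unfolding i_def using not_less_Least by blast
  ultimately have "on_schedule i (state i)" by (intro on_schedule_state)
  then have "M i = {}" "alloc (state i) = A i" using e by (auto simp: on_schedule_def)
  then show ?thesis using PRE_eq_alloc[OF e] by (simp add: fun_eq_iff acquired_all)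
qed

end

theorem theorem4:
  fixes R :: "'a::finite \<Rightarrow> 'b::finite rel"
    and P :: "'a \<Rightarrow> 'b \<Rightarrow> real"
  assumes "CARD('a) = CARD('b)"
    and "preference_profile R"
    and "random_assignment P"
  shows "ea_FERI R P \<longleftrightarrow> (\<exists>\<omega>. eating_speeds \<omega> \<and> P = PRE \<omega> R)"
proof
  assume "ea_FERI R P"
  then interpret feri_assignment R P using assms by unfold_locales
  show "\<exists>\<omega>. eating_speeds \<omega> \<and> P = PRE \<omega> R"
    using eating_speeds_\<omega> PRE_\<omega> by metis
next
  assume "\<exists>\<omega>. eating_speeds \<omega> \<and> P = PRE \<omega> R"
  then obtain \<omega> where \<omega>: "eating_speeds \<omega>" "P = PRE \<omega> R" by blast
  then interpret pre_run R \<omega> using assms by unfold_locales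
  show "ea_FERI R P" using PRE_ea_FERI assms(3) \<omega>(2) by simp
qed

end
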